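(* Let $X$ and $Y$ be non-empty metric spaces that are bi-Lipschitz equivalent, i.e. there exists a bi-Lipschitz bijection between $X$ and $Y$. Then \[ \dim_{\mathrm L}X=\dim_{\mathrm L}Y . \]
   Context: A map $\phi:X\to Y$ is bi-Lipschitz if there are constants $a,b>0$ with $a\,d_X(x,y)\leq d_Y(\phi(x),\phi(y))\leq b\,d_X(x,y)$ for all $x,y\in X$. For a metric space $X$, $N_r(F)$ denotes the smallest number of open sets of diameter at most $r$ needed to cover $F\subseteq X$ (possibly $\infty$), $B(x,R)$ is the closed ball, and the lower dimension is \[ \dim_{\mathrm L}X=\sup\Big\{\alpha:\ \exists\, C,\rho>0 \text{ such that for all } 0<r<R\leq\rho,\ \inf_{x\in X}N_r(B(x,R))\geq C (R/r)^{\alpha}\Big\}\in[0,\infty]. \] *)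

theory Defs
  imports "HOL-Analysis.Analysis"
begin

definition bi_Lipschitz_map :: "'a metric \<Rightarrow> 'b metric \<Rightarrow> ('a \<Rightarrow> 'b) \<Rightarrow> bool" where
  "bi_Lipschitz_map X Y \<phi> \<longleftrightarrow>
     \<phi> \<in> mspace X \<rightarrow> mspace Y \<and>
     (\<exists>a>0. \<exists>b>0. \<forall>x\<in>mspace X. \<forall>y\<in>mspace X.
        a * mdist X x y \<le> mdist Y (\<phi> x) (\<phi> y) \<and> mdist Y (\<phi> x) (\<phi> y) \<le> b * mdist X x y)"

definition bi_Lipschitz_equivalent :: "'a metric \<Rightarrow> 'b metric \<Rightarrow> bool" where
  "bi_Lipschitz_equivalent X Y \<longleftrightarrow>
     (\<exists>\<phi>. bi_Lipschitz_map X Y \<phi> \<and> bij_betw \<phi> (mspace X) (mspace Y))"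

text \<open>The library's \<^const>\<open>diameter\<close> is real-valued, hence unspecified on unbounded sets, and is
  restricted to the class \<^class>\<open>metric_space\<close>. Here an unbounded set has diameter \<open>\<infinity>\<close>
  and the empty set has diameter 0.\<close>

definition mdiameter_of :: "'a metric \<Rightarrow> 'a set \<Rightarrow> ennreal" where
  "mdiameter_of X U = (SUP x\<in>U. SUP y\<in>U. ennreal (mdist X x y))"

text \<open>\<open>\<infinity>\<close>, the infimum of the empty set in \<^typ>\<open>enat\<close>, is the value when there is no finite cover.\<close>

definition covering_number :: "'a metric \<Rightarrow> real \<Rightarrow> 'a set \<Rightarrow> enat" where
  "covering_number X r F =
     Inf {enat (card \<U>) |\<U>. finite \<U> \<and> F \<subseteq> \<Union>\<U> \<and>
            (\<forall>U\<in>\<U>. openin (mtopology_of X) U \<and> mdiameter_of X U \<le> ennreal r)}"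

text \<open>The exponent \<open>\<alpha> = 0\<close> is always admissible (with \<open>C = 1\<close>), so the
  supremum lies in \<open>[0, \<infinity>]\<close> although \<open>\<alpha>\<close> ranges over all reals; see the lemma below.\<close>

definition lower_dimension :: "'a metric \<Rightarrow> ereal" where
  "lower_dimension X =
     Sup {ereal \<alpha> |\<alpha>. \<exists>C>0. \<exists>\<rho>>0. \<forall>r R. 0 < r \<and> r < R \<and> R \<le> \<rho> \<longrightarrow>
            ereal (C * (R / r) powr \<alpha>)
              \<le> ereal_of_enat (INF x\<in>mspace X. covering_number X r (mcball_of X x R))}"

lemma lower_dimension_nonneg: "0 \<le> lower_dimension X"
proof -
  have one: "1 \<le> covering_number X r (mcball_of X x R)"
    if "x \<in> mspace X" "0 < R" for x r R
    unfolding covering_number_def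
  proof (rule Inf_greatest, clarsimp)
    fix \<U> :: "'a set set"
    assume "finite \<U>" "mcball_of X x R \<subseteq> \<Union>\<U>"
    moreover have "x \<in> mcball_of X x R" using that by (simp add: Metric_space.mdist_zero[OF Metric_space_mspace_mdist])
    ultimately have "card \<U> \<noteq> 0" by auto
    then show "1 \<le> enat (card \<U>)" by (simp add: one_enat_def)
  qed
  have "ereal (1 * (R / r) powr 0)
          \<le> ereal_of_enat (INF x\<in>mspace X. covering_number X r (mcball_of X x R))"
    if "0 < r" "r < R" for r R
  proof -
    have "1 \<le> (INF x\<in>mspace X. covering_number X r (mcball_of X x R))"
      using that by (intro INF_greatest one) auto
    then have "ereal_of_enat 1 
         \<le> ereal_of_enat (INF x\<in>mspace X. covering_number X r (mcball_of X x R))"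
      by (simp only: ereal_of_enat_le_iff)
    then show ?thesis using that by (simp add: one_enat_def one_ereal_def)
  qed
  then have "\<exists>C>0. \<exists>\<rho>>0. \<forall>r R. 0 < r \<and> r < R \<and> R \<le> \<rho> \<longrightarrow>
            ereal (C * (R / r) powr 0)
              \<le> ereal_of_enat (INF x\<in>mspace X. covering_number X r (mcball_of X x R))"
    by (intro exI[of _ "1::real"] conjI) auto
  then have "ereal 0 \<le> lower_dimension X"
    unfolding lower_dimension_def by (intro Sup_upper) blast
  then show ?thesis by (simp add: zero_ereal_def)
qed

end

theory Submission
  imports Defs
begin

text \<open>A bi-Lipschitz bijection with constants \<open>a\<close> and \<open>b\<close> distorts both scales in the definition
  of the lower dimension by bounded factors only. Pulling a cover of \<open>B(\<phi>(x), R)\<close> by sets of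
  diameter at most \<open>r\<close> back along \<open>\<phi>\<close> yields a cover of \<open>B(x, R/b)\<close> by sets of diameter at
  most \<open>r/a\<close>, so that \<open>N\<^sub>r(B(\<phi>(x), R)) \<ge> N\<^bsub>r/a\<^esub>(B(x, R/b))\<close>
  (\<open>covering_number_le_of_expanding\<close>). A lower bound \<open>C(R/r)\<^sup>\<alpha>\<close> in the
  domain thus becomes \<open>C(a/b)\<^sup>\<alpha>(R/r)\<^sup>\<alpha>\<close> in the target, as long as \<open>r/a < R/b\<close>. In the
  remaining range \<open>R/r\<close> is at most \<open>b/a\<close>, and the trivial bound \<open>N \<ge> 1\<close> suffices after
  shrinking the constant. Since \<open>\<phi>\<close> is onto, every ball of the target is centred
  at some \<open>\<phi>(x)\<close>, so each non-negative exponent admissible for the domain is admissible for the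
  target; hence the lower dimension does not decrease. The inverse of \<open>\<phi>\<close> gives the
  other inequality.\<close>

lemma one_le_covering_number:
  assumes "F \<noteq> {}"
  shows "1 \<le> covering_number X r F"
  unfolding covering_number_def
proof (rule Inf_greatest, clarsimp)
  fix \<U> :: "'a set set"
  assume "finite \<U>" "F \<subseteq> \<Union>\<U>"
  with assms have "card \<U> \<noteq> 0" by auto
  then show "1 \<le> enat (card \<U>)" by (simp add: one_enat_def)
qed

text \<open>Continuity makes the preimages of a cover open, and the expansion bound controls
  their diameters. Distinct sets may have equal preimages, so the cover can
  only get smaller.\<close>

lemma covering_number_le_of_expanding:
  assumes cont: "continuous_map (mtopology_of X) (mtopology_of Y) \<phi>"
    and expand: "\<And>x y. x \<in> mspace X \<Longrightarrow> y \<in> mspace X \<Longrightarrow> a * mdist X x y \<le> mdist Y (\<phi> x) (\<phi> y)"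
    and "a > 0" "r \<ge> 0" and F: "F \<subseteq> mspace X" "\<phi> ` F \<subseteq> G"
  shows "covering_number X (r / a) F \<le> covering_number Y r G"
  unfolding covering_number_def[of Y]
proof (rule Inf_greatest, clarsimp)
  fix \<U> :: "'b set set"
  assume fin: "finite \<U>" and cover: "G \<subseteq> \<Union>\<U>"
    and \<U>: "\<forall>U\<in>\<U>. openin (mtopology_of Y) U \<and> mdiameter_of Y U \<le> ennreal r"
  define pre where "pre U = {x \<in> mspace X. \<phi> x \<in> U}" for U
  have "openin (mtopology_of X) (pre U)" if "U \<in> \<U>" for U
    using openin_continuous_map_preimage[OF cont, of U] \<U> that by (simp add: pre_def)
  moreover have "mdiameter_of X (pre U) \<le> ennreal (r / a)" if "U \<in> \<U>" for U
    unfolding mdiameter_of_def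
  proof (intro SUP_least ennreal_leI)
    fix x y assume xy: "x \<in> pre U" "y \<in> pre U"
    have "ennreal (mdist Y (\<phi> x) (\<phi> y)) \<le> mdiameter_of Y U"
      unfolding mdiameter_of_def using xy
      by (intro SUP_upper2[of "\<phi> x"] SUP_upper2[of "\<phi> y"]) (auto simp: pre_def)
    also have "\<dots> \<le> ennreal r" using \<U> that by blast
    finally have "mdist Y (\<phi> x) (\<phi> y) \<le> r" using \<open>r \<ge> 0\<close> by simp
    with expand[of x y] xy have "a * mdist X x y \<le> r" by (auto simp: pre_def)
    then show "mdist X x y \<le> r / a" using \<open>a > 0\<close> by (simp add: field_simps)
  qed
  moreover have "F \<subseteq> \<Union>(pre ` \<U>)" using F cover by (fastforce simp: pre_def)
  ultimately have "covering_number X (r / a) F \<le> enat (card (pre ` \<U>))"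
    unfolding covering_number_def using fin by (intro Inf_lower) blast
  also have "\<dots> \<le> enat (card \<U>)" using fin by (simp add: card_image_le)
  finally show "covering_number X (r / a) F \<le> enat (card \<U>)" .
qed

lemma covering_number_mcball_bi_Lipschitz:
  assumes maps: "\<phi> \<in> mspace X \<rightarrow> mspace Y" and "a > 0" "b > 0" "r \<ge> 0"
    and lower: "\<And>x y. x \<in> mspace X \<Longrightarrow> y \<in> mspace X \<Longrightarrow> a * mdist X x y \<le> mdist Y (\<phi> x) (\<phi> y)"
    and upper: "\<And>x y. x \<in> mspace X \<Longrightarrow> y \<in> mspace X \<Longrightarrow> mdist Y (\<phi> x) (\<phi> y) \<le> b * mdist X x y"
  shows "covering_number X (r / a) (mcball_of X x (R / b))
           \<le> covering_number Y r (mcball_of Y (\<phi> x) R)"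
proof (rule covering_number_le_of_expanding[OF _ lower \<open>a > 0\<close> \<open>r \<ge> 0\<close>])
  have "Lipschitz_continuous_map X Y \<phi>"
    unfolding Lipschitz_continuous_map_def using maps upper by blast
  then show "continuous_map (mtopology_of X) (mtopology_of Y) \<phi>"
    by (intro uniformly_continuous_imp_continuous_map
        Lipschitz_imp_uniformly_continuous_map)
  show "mcball_of X x (R / b) \<subseteq> mspace X" by auto
  show "\<phi> ` mcball_of X x (R / b) \<subseteq> mcball_of Y (\<phi> x) R"
  proof clarsimp
    fix y assume y: "x \<in> mspace X" "y \<in> mspace X" "mdist X x y \<le> R / b"
    then have "mdist Y (\<phi> x) (\<phi> y) \<le> R"
      using upper[of x y] \<open>b > 0\<close> by (simp add: field_simps)
    then show "\<phi> x \<in> mspace Y \<and> \<phi> y \<in> mspace Y \<and> mdist Y (\<phi> x) (\<phi> y) \<le> R"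
      using maps y by auto
  qed
qed

text \<open>Negative exponents are dominated by \<open>0\<close>, so the exponent can be taken non-negative. This makes
  \<open>t \<mapsto> t\<^sup>\<alpha>\<close> monotone, as the range \<open>R/r \<le> b/a\<close> requires.\<close>

lemma lower_dimension_le_of_bi_Lipschitz_equivalent:
  assumes "bi_Lipschitz_equivalent X Y"
  shows "lower_dimension X \<le> lower_dimension Y"
proof -
  obtain \<phi> where "bi_Lipschitz_map X Y \<phi>" and onto: "\<phi> ` mspace X = mspace Y"
    using assms unfolding bi_Lipschitz_equivalent_def bij_betw_def by blast
  then obtain a b where maps: "\<phi> \<in> mspace X \<rightarrow> mspace Y" and ab: "a > 0" "b > 0"
    and bounds: "\<forall>x\<in>mspace X. \<forall>y\<in>mspace X.
      a * mdist X x y \<le> mdist Y (\<phi> x) (\<phi> y) \<and> mdist Y (\<phi> x) (\<phi> y) \<le> b * mdist X x y"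
    unfolding bi_Lipschitz_map_def by (elim conjE exE)
  let ?N = "\<lambda>Z r R. INF z\<in>mspace Z. covering_number Z r (mcball_of Z z R)"
  have compare: "?N X (r / a) (R / b) \<le> ?N Y r R" if "r \<ge> 0" for r R
  proof (rule INF_greatest)
    fix y assume "y \<in> mspace Y"
    with onto obtain x where x: "x \<in> mspace X" "y = \<phi> x" by auto
    show "?N X (r / a) (R / b) \<le> covering_number Y r (mcball_of Y y R)"
      using covering_number_mcball_bi_Lipschitz[OF maps ab that] bounds
      by (intro INF_lower2[OF x(1)]) (simp add: x(2))
  qed
  have one_le: "1 \<le> ?N Y r R" if "R > 0" for r R
  proof (intro INF_greatest one_le_covering_number)
    fix y assume "y \<in> mspace Y"
    then have "y \<in> mcball_of Y y R"
      using that by (simp add: Metric_space.mdist_zero[OF Metric_space_mspace_mdist])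
    then show "mcball_of Y y R \<noteq> {}" by blast
  qed
  show ?thesis
    unfolding lower_dimension_def[of X]
  proof (rule Sup_least, clarify)
    fix \<alpha> C \<rho> :: real
    assume pos: "C > 0" "\<rho> > 0"
      and bound: "\<forall>r R. 0 < r \<and> r < R \<and> R \<le> \<rho> \<longrightarrow>
        ereal (C * (R / r) powr \<alpha>) \<le> ereal_of_enat (?N X r R)"
    show "ereal \<alpha> \<le> lower_dimension Y"
    proof (cases "\<alpha> \<ge> 0")
      case False
      then show ?thesis
        using order_trans[OF _ lower_dimension_nonneg, of "ereal \<alpha>" Y] by simp
    next
      case True
      \<comment> \<open>\<open>min C 1\<close> serves both ranges of scales: \<open>C\<close> for \<open>r/a < R/b\<close>, and \<open>1\<close> for the rest.\<close>
      define D where "D = min C 1 * (a / b) powr \<alpha>"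
      have "ereal (D * (R / r) powr \<alpha>) \<le> ereal_of_enat (?N Y r R)"
        if r: "0 < r" "r < R" "R \<le> b * \<rho>" for r R
      proof -
        \<comment> \<open>the ratio of the two scales after they are transported to \<open>X\<close>\<close>
        define t where "t = (R / b) / (r / a)"
        have "t > 0" using r ab by (simp add: t_def)
        have "D * (R / r) powr \<alpha> = min C 1 * ((a / b) * (R / r)) powr \<alpha>"
          using r ab by (subst powr_mult) (simp_all add: D_def)
        also have "(a / b) * (R / r) = t" by (simp add: t_def)
        finally have D: "D * (R / r) powr \<alpha> = min C 1 * t powr \<alpha>" .
        show ?thesis
        proof (cases "r / a < R / b")
          case True
          have "D * (R / r) powr \<alpha> \<le> C * t powr \<alpha>"
            unfolding D by (intro mult_right_mono) auto
          then have "ereal (D * (R / r) powr \<alpha>) \<le> ereal (C * t powr \<alpha>)" by simp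
          also have "\<dots> \<le> ereal_of_enat (?N X (r / a) (R / b))"
            unfolding t_def by (rule bound[rule_format]) (use True r ab in \<open>simp add: field_simps\<close>)
          also have "\<dots> \<le> ereal_of_enat (?N Y r R)"
            using compare[of r R] r by (simp only: ereal_of_enat_le_iff)
          finally show ?thesis .
        next
          case False
          then have "t \<le> 1" using r ab by (simp add: t_def field_simps)
          then have "t powr \<alpha> \<le> 1" using \<open>t > 0\<close> \<open>\<alpha> \<ge> 0\<close> by (simp add: powr_le1)
          then have "min C 1 * t powr \<alpha> \<le> 1 * 1" using pos by (intro mult_mono) auto
          then have "ereal (D * (R / r) powr \<alpha>) \<le> ereal_of_enat 1"
            by (simp add: D one_enat_def)
          also have "\<dots> \<le> ereal_of_enat (?N Y r R)"
            using one_le[of R r] r by (simp only: ereal_of_enat_le_iff)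
          finally show ?thesis .
        qed
      qed
      moreover have "D > 0" "b * \<rho> > 0" using pos ab by (simp_all add: D_def)
      ultimately show ?thesis
        unfolding lower_dimension_def by (intro Sup_upper) blast
    qed
  qed
qed

lemma bi_Lipschitz_equivalent_sym:
  assumes "bi_Lipschitz_equivalent X Y"
  shows "bi_Lipschitz_equivalent Y X"
proof -
  obtain \<phi> a b where bij: "bij_betw \<phi> (mspace X) (mspace Y)" and ab: "a > 0" "b > 0"
    and bounds: "\<And>x y. x \<in> mspace X \<Longrightarrow> y \<in> mspace X \<Longrightarrow>
      a * mdist X x y \<le> mdist Y (\<phi> x) (\<phi> y) \<and> mdist Y (\<phi> x) (\<phi> y) \<le> b * mdist X x y"
    using assms unfolding bi_Lipschitz_equivalent_def bi_Lipschitz_map_def by blast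
  let ?\<psi> = "inv_into (mspace X) \<phi>"
  have bij': "bij_betw ?\<psi> (mspace Y) (mspace X)" by (rule bij_betw_inv_into[OF bij])
  have maps: "?\<psi> y \<in> mspace X" if "y \<in> mspace Y" for y
    using bij_betw_apply[OF bij' that] .
  have "1 / b * mdist Y u v \<le> mdist X (?\<psi> u) (?\<psi> v) \<and> mdist X (?\<psi> u) (?\<psi> v) \<le> 1 / a * mdist Y u v"
    if "u \<in> mspace Y" "v \<in> mspace Y" for u v
    using bounds[OF maps[OF that(1)] maps[OF that(2)]] ab that
    by (simp add: bij_betw_inv_into_right[OF bij] field_simps)
  moreover have "1 / a > 0" "1 / b > 0" using ab by simp_all
  ultimately have "bi_Lipschitz_map Y X ?\<psi>"
    unfolding bi_Lipschitz_map_def using maps by blast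
  with bij' show ?thesis unfolding bi_Lipschitz_equivalent_def by blast
qed

theorem theorem2p4:
  fixes X :: "'a metric" and Y :: "'b metric"
  assumes "mspace X \<noteq> {}" and "mspace Y \<noteq> {}"
    and "bi_Lipschitz_equivalent X Y"
  shows "lower_dimension X = lower_dimension Y"
  using assms(3) by (intro antisym lower_dimension_le_of_bi_Lipschitz_equivalent)
    (auto intro: bi_Lipschitz_equivalent_sym)

end
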